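(* Assume the compactness and lower semicontinuity conditions (A) and the triangle-type condition (B) stated in the context. For noise levels $\delta\to0^+$ let $y^\delta\in Y$ satisfy $\phi(x^\dagger,y^\delta)=\delta^2$, let $\boldsymbol\eta(\delta)=(\eta_1(\delta),\eta_2(\delta))$ with $\eta_1(\delta),\eta_2(\delta)>0$, and let $x^\delta_{\boldsymbol\eta}$ be a minimizer over $Q_{\mathrm{ad}}$ of $J_{\boldsymbol\eta(\delta)}(x)=\phi(x,y^\delta)+\eta_1(\delta)\psi_1(x)+\eta_2(\delta)\psi_2(x)$ such that the discrepancy equation $$\phi(x^\delta_{\boldsymbol\eta},y^\delta)=c_m\delta^2$$ holds, where $c_m\ge1$ is a fixed constant. Suppose that a subsequence $\{\boldsymbol\eta(\delta)\}_\delta$ converges and that, along it, $\tilde\eta:=\lim_{\delta\to0}\frac{\eta_1(\delta)}{\eta_2(\delta)}$ exists (as a finite number) and $\tilde\eta>0$. Then the corresponding sequence of minimizers $\{x^\delta_{\boldsymbol\eta}\}_\delta$ contains a subsequence converging in the $\tau$-topology to an $\tilde\eta\psi_1+\psi_2$-minimizing solution, and $$\lim_{\delta\to0}\left(\frac{\eta_1(\delta)}{\eta_2(\delta)}\psi_1(x^\delta_{\boldsymbol\eta})+\psi_2(x^\delta_{\boldsymbol\eta})\right)=\tilde\eta\psi_1(x^\dagger)+\psi_2(x^\dagger).$$ Moreover, if the $\tilde\eta\psi_1+\psi_2$-minimizing solution is unique, then the whole subsequence $\{x^\delta_{\boldsymbol\eta}\}_\delta$ converges in the $\tau$-topology.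
   Context: Setting: $X,Y$ are Banach spaces, $K:X\to Y$ is bounded and linear, $Q_{\mathrm{ad}}\subset X$ is a convex constraint set, and $\tau$ is a fixed topology on $X$. The fidelity is $\phi:X\times Y\to[0,\infty)$, and the penalties $\psi_1,\psi_2:X\to[0,\infty]$ are convex and (weakly) lower semicontinuous. The exact solution $x^\dagger\in Q_{\mathrm{ad}}$ satisfies $\psi_i(x^\dagger)<\infty$ for $i=1,2$, and $y^\dagger=Kx^\dagger$ is the exact data. An $\tilde\eta\psi_1+\psi_2$-minimizing solution is an element minimizing $\tilde\eta\psi_1(x)+\psi_2(x)$ over $\{x\in Q_{\mathrm{ad}}:Kx=y^\dagger\}$. Condition (A): for every $y\in Y$, (i) any sequence $\{x_n\}\subset Q_{\mathrm{ad}}$ along which $\phi(x_n,y)$, $\psi_1(x_n)$, $\psi_2(x_n)$ are uniformly bounded has a subsequence converging in the $\tau$-topology to an element of $Q_{\mathrm{ad}}$; (ii) $\phi(\cdot,y)$, $\psi_1$, $\psi_2$ are lower semicontinuous along $\tau$-convergent sequences, i.e. if $\{x_n\}\subset Q_{\mathrm{ad}}$ converges to $x^*\in Q_{\mathrm{ad}}$ in the $\tau$-topology, then $\phi(x^*,y)\le\liminf_n\phi(x_n,y)$ and $\psi_i(x^* )\le\liminf_n\psi_i(x_n)$. Condition (B): $\phi(x,y)=0$ if and only if $Kx=y$, and there is a constant $c$ such that $\phi(x,y)\le c\,(\phi(x',y')+\phi(x,y'))$ for all $x\in X$, $y,y'\in Y$ and any $x'\in X$ with $Kx'=y$.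
   Formalization: The formal theorem additionally assumes that the exact solution x† is itself an η̃ψ₁+ψ₂-minimizing solution; for an arbitrary exact solution the limit formula, and in general also the convergence to a minimizing solution, is false. *)

theory Defs
  imports "HOL-Analysis.Analysis"
begin

text \<open>Convexity of a \<open>[0,\<infinity>]\<close>-valued functional, with the convention \<open>0 \<cdot> \<infinity> = 0\<close> of \<^typ>\<open>ennreal\<close>.\<close>

definition convex_penalty :: "('a::real_vector \<Rightarrow> ennreal) \<Rightarrow> bool" where
  "convex_penalty \<psi> \<longleftrightarrow>
     (\<forall>x y t. 0 \<le> t \<and> t \<le> 1 \<longrightarrow>
        \<psi> ((1 - t) *\<^sub>R x + t *\<^sub>R y) \<le> ennreal (1 - t) * \<psi> x + ennreal t * \<psi> y)"

text \<open>Lower semicontinuity with respect to the norm topology. For convex functionals on a Banach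
  space it coincides with weak lower semicontinuity (Mazur); without convexity it is the weaker of
  the two properties.\<close>

definition lsc :: "('a::topological_space \<Rightarrow> ennreal) \<Rightarrow> bool" where
  "lsc \<psi> \<longleftrightarrow> (\<forall>a. closed {x. \<psi> x \<le> a})"

definition tikhonov ::
  "('a \<Rightarrow> 'b \<Rightarrow> real) \<Rightarrow> ('a \<Rightarrow> ennreal) \<Rightarrow> ('a \<Rightarrow> ennreal) \<Rightarrow> 'b \<Rightarrow> real \<Rightarrow> real \<Rightarrow> 'a \<Rightarrow> ennreal" where
  "tikhonov \<phi> \<psi>1 \<psi>2 y \<eta>1 \<eta>2 x = ennreal (\<phi> x y) + ennreal \<eta>1 * \<psi>1 x + ennreal \<eta>2 * \<psi>2 x"

definition minimizing_solution ::
  "('a \<Rightarrow> 'b) \<Rightarrow> 'a set \<Rightarrow> ('a \<Rightarrow> ennreal) \<Rightarrow> ('a \<Rightarrow> ennreal) \<Rightarrow> 'b \<Rightarrow> real \<Rightarrow> 'a \<Rightarrow> bool" where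
  "minimizing_solution K Q \<psi>1 \<psi>2 ydag \<eta> x \<longleftrightarrow>
     is_arg_min (\<lambda>x. ennreal \<eta> * \<psi>1 x + \<psi>2 x) (\<lambda>x. x \<in> Q \<and> K x = ydag) x"

definition compactness_condition ::
  "'a topology \<Rightarrow> 'a set \<Rightarrow> ('a \<Rightarrow> 'b \<Rightarrow> real) \<Rightarrow> ('a \<Rightarrow> ennreal) \<Rightarrow> ('a \<Rightarrow> ennreal) \<Rightarrow> bool" where
  "compactness_condition \<tau> Q \<phi> \<psi>1 \<psi>2 \<longleftrightarrow>
     (\<forall>y. \<forall>x :: nat \<Rightarrow> 'a.
        (\<forall>n. x n \<in> Q) \<and>
        (\<exists>M::real. \<forall>n. \<phi> (x n) y \<le> M \<and> \<psi>1 (x n) \<le> ennreal M \<and> \<psi>2 (x n) \<le> ennreal M) \<longrightarrow>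
        (\<exists>r xs. strict_mono (r :: nat \<Rightarrow> nat) \<and> xs \<in> Q \<and> limitin \<tau> (x \<circ> r) xs sequentially))"

definition sequential_lsc_condition ::
  "'a topology \<Rightarrow> 'a set \<Rightarrow> ('a \<Rightarrow> 'b \<Rightarrow> real) \<Rightarrow> ('a \<Rightarrow> ennreal) \<Rightarrow> ('a \<Rightarrow> ennreal) \<Rightarrow> bool" where
  "sequential_lsc_condition \<tau> Q \<phi> \<psi>1 \<psi>2 \<longleftrightarrow>
     (\<forall>y. \<forall>x :: nat \<Rightarrow> 'a. \<forall>xs.
        (\<forall>n. x n \<in> Q) \<and> xs \<in> Q \<and> limitin \<tau> x xs sequentially \<longrightarrow>
        ennreal (\<phi> xs y) \<le> liminf (\<lambda>n. ennreal (\<phi> (x n) y)) \<and>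
        \<psi>1 xs \<le> liminf (\<lambda>n. \<psi>1 (x n)) \<and>
        \<psi>2 xs \<le> liminf (\<lambda>n. \<psi>2 (x n)))"

definition triangle_condition :: "('a \<Rightarrow> 'b) \<Rightarrow> ('a \<Rightarrow> 'b \<Rightarrow> real) \<Rightarrow> bool" where
  "triangle_condition K \<phi> \<longleftrightarrow>
     (\<forall>x y. \<phi> x y = 0 \<longleftrightarrow> K x = y) \<and>
     (\<exists>c. \<forall>x x' y y'. K x' = y \<longrightarrow> \<phi> x y \<le> c * (\<phi> x' y' + \<phi> x y'))"

end

theory Submission
  imports Defs
begin

text \<open>
  Write \<open>x\<^sub>n\<close> for the minimizer at the \<open>n\<close>-th noise level \<open>\<delta>\<^sub>n\<close> and
  \<open>\<rho>\<^sub>n = \<eta>\<^sub>1 / \<eta>\<^sub>2\<close> for the ratio of the weights there. The discrepancy equation with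
  \<open>c\<^sub>m \<ge> 1\<close> says that the exact solution \<open>x\<^sup>\<dagger>\<close> fits the noisy data at least as well as \<open>x\<^sub>n\<close> does.
  Since \<open>x\<^sub>n\<close> nevertheless has the smaller Tikhonov value, it must win on the penalty side:
  after division by \<open>\<eta>\<^sub>2\<close>,
  \<open>\<rho>\<^sub>n \<psi>\<^sub>1(x\<^sub>n) + \<psi>\<^sub>2(x\<^sub>n) \<le> \<rho>\<^sub>n \<psi>\<^sub>1(x\<^sup>\<dagger>) + \<psi>\<^sub>2(x\<^sup>\<dagger>)\<close>
  (\<open>discrepancy_penalty_le\<close>). This inequality drives the rest.

  Because \<open>\<rho>\<^sub>n\<close> tends to \<open>\<eta> > 0\<close>, it stays away from \<open>0\<close> and \<open>\<infinity>\<close>, so both penalties are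
  bounded along \<open>x\<^sub>n\<close> (\<open>penalties_bounded\<close>). The triangle-type condition turns the two
  discrepancies, of order \<open>\<delta>\<^sub>n\<^sup>2\<close>, into \<open>\<phi>(x\<^sub>n, y\<^sup>\<dagger>) \<rightarrow> 0\<close>. Compactness then gives \<open>\<tau>\<close>-cluster points, and
  lower semicontinuity shows that such a point solves the exact equation and has penalty at most
  \<open>\<eta> \<psi>\<^sub>1(x\<^sup>\<dagger>) + \<psi>\<^sub>2(x\<^sup>\<dagger>)\<close>. As \<open>x\<^sup>\<dagger>\<close> is itself minimizing, the cluster point is minimizing too, and the
  limit inferior of the penalty values along the subsequence is at least the minimum
  (\<open>subsequence_tends_to_minimizing_solution\<close>). The inequality above bounds the limit
  superior by the same number.

  Every subsequence of \<open>x\<^sub>n\<close> satisfies the same hypotheses. So every subsequence has a further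
  one with these properties, which upgrades the convergence of the penalty values, and of
  \<open>x\<^sub>n\<close> itself when only one limit is possible, from subsequences to the full sequence.
\<close>

section \<open>Subsequences and limits inferior\<close>

text \<open>The subsequence principle at the level of eventual properties. This form serves both the
  limit of the penalty values and a limit in an abstract topology.\<close>

lemma eventually_sequentially_if_subsequences:
  assumes "\<And>r :: nat \<Rightarrow> nat. strict_mono r \<Longrightarrow>
    \<exists>s :: nat \<Rightarrow> nat. eventually (\<lambda>n. P (r (s n))) sequentially"
  shows "eventually P sequentially"
proof (rule ccontr)
  assume "\<not> eventually P sequentially"
  then obtain r :: "nat \<Rightarrow> nat" where r: "strict_mono r" "\<And>n. \<not> P (r n)"
    using not_eventually_sequentiallyD by blast
  show False
    using assms[OF r(1)] r(2) by simp
qed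

lemma liminf_add_ennreal:
  fixes f g :: "nat \<Rightarrow> ennreal"
  shows "liminf f + liminf g \<le> liminf (\<lambda>n. f n + g n)"
proof -
  have "liminf f + liminf g = (SUP n. (INF m\<in>{n..}. f m) + (INF m\<in>{n..}. g m))"
    unfolding liminf_SUP_INF
    by (rule ennreal_SUP_add[symmetric])
       (auto simp: incseq_def intro!: INF_superset_mono)
  also have "\<dots> \<le> liminf (\<lambda>n. f n + g n)"
    unfolding liminf_SUP_INF
    by (intro SUP_mono bexI[OF _ UNIV_I] INF_greatest add_mono INF_lower) auto
  finally show ?thesis .
qed

text \<open>Since both factors are suprema of tail infima, the two suprema can be taken
  one after the other; monotonicity of the tails merges the two indices by their maximum.\<close>

lemma liminf_mult_ennreal:
  fixes f g :: "nat \<Rightarrow> ennreal"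
  shows "liminf f * liminf g \<le> liminf (\<lambda>n. f n * g n)"
proof -
  have "(INF m\<in>{i..}. f m) * (INF m\<in>{j..}. g m) \<le> liminf (\<lambda>n. f n * g n)" for i j
  proof -
    have "(INF m\<in>{i..}. f m) * (INF m\<in>{j..}. g m) \<le> (INF n\<in>{max i j..}. f n * g n)"
      by (intro INF_greatest mult_mono INF_lower) auto
    also have "\<dots> \<le> liminf (\<lambda>n. f n * g n)"
      unfolding liminf_SUP_INF by (rule SUP_upper) simp
    finally show ?thesis .
  qed
  then show ?thesis
    unfolding liminf_SUP_INF[of f] liminf_SUP_INF[of g]
    by (auto simp: SUP_mult_left_ennreal SUP_mult_right_ennreal intro!: SUP_least)
qed

section \<open>Penalty bounds from the discrepancy principle\<close>

text \<open>Fidelity at \<open>x'\<close> is no larger than at the minimizer \<open>x\<close>, so it can be cancelled from the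
  comparison of Tikhonov values.\<close>

lemma discrepancy_penalty_le:
  assumes min: "is_arg_min (tikhonov \<phi> \<psi>1 \<psi>2 y \<eta>1 \<eta>2) (\<lambda>x. x \<in> Q) x"
    and x': "x' \<in> Q" "\<phi> x' y \<le> \<phi> x y"
    and pos: "0 < \<eta>1" "0 < \<eta>2"
  shows "ennreal (\<eta>1 / \<eta>2) * \<psi>1 x + \<psi>2 x \<le> ennreal (\<eta>1 / \<eta>2) * \<psi>1 x' + \<psi>2 x'"
proof -
  have scale: "ennreal (1 / \<eta>2) * (ennreal \<eta>1 * a + ennreal \<eta>2 * b) = ennreal (\<eta>1 / \<eta>2) * a + b"
    for a b :: ennreal
    using pos by (simp add: distrib_left mult.assoc[symmetric] ennreal_mult[symmetric])
  have "tikhonov \<phi> \<psi>1 \<psi>2 y \<eta>1 \<eta>2 x \<le> tikhonov \<phi> \<psi>1 \<psi>2 y \<eta>1 \<eta>2 x'"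
    using min x'(1) by (auto simp: is_arg_min_def not_less)
  then have "ennreal (\<phi> x y) + (ennreal \<eta>1 * \<psi>1 x + ennreal \<eta>2 * \<psi>2 x)
      \<le> ennreal (\<phi> x' y) + (ennreal \<eta>1 * \<psi>1 x' + ennreal \<eta>2 * \<psi>2 x')"
    by (simp add: tikhonov_def add.assoc)
  also have "\<dots> \<le> ennreal (\<phi> x y) + (ennreal \<eta>1 * \<psi>1 x' + ennreal \<eta>2 * \<psi>2 x')"
    by (intro add_right_mono ennreal_leI x'(2))
  finally have "ennreal \<eta>1 * \<psi>1 x + ennreal \<eta>2 * \<psi>2 x \<le> ennreal \<eta>1 * \<psi>1 x' + ennreal \<eta>2 * \<psi>2 x'"
    by (simp add: ennreal_add_left_cancel_le)
  then have "ennreal (1 / \<eta>2) * (ennreal \<eta>1 * \<psi>1 x + ennreal \<eta>2 * \<psi>2 x)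
      \<le> ennreal (1 / \<eta>2) * (ennreal \<eta>1 * \<psi>1 x' + ennreal \<eta>2 * \<psi>2 x')"
    by (rule mult_left_mono) simp
  then show ?thesis
    by (simp only: scale)
qed

text \<open>A positive limit of positive weights bounds both the weights and their reciprocals; the former
  controls the second penalty, the latter the first one.\<close>

lemma penalties_bounded:
  fixes \<rho> :: "nat \<Rightarrow> real" and u v :: "nat \<Rightarrow> ennreal" and a b :: ennreal
  assumes le: "\<And>n. ennreal (\<rho> n) * u n + v n \<le> ennreal (\<rho> n) * a + b"
    and fin: "a < \<infinity>" "b < \<infinity>"
    and \<rho>: "\<And>n. 0 < \<rho> n" "\<rho> \<longlonglongrightarrow> \<eta>" "0 < \<eta>"
  shows "\<exists>M::real. \<forall>n. u n \<le> ennreal M \<and> v n \<le> ennreal M"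
proof -
  obtain p where p: "a = ennreal p" "0 \<le> p"
    using fin(1) by (cases a) auto
  obtain q where q: "b = ennreal q" "0 \<le> q"
    using fin(2) by (cases b) auto
  obtain R where R: "\<And>n. \<rho> n \<le> R"
    using convergent_imp_Bseq[OF convergentI[OF \<rho>(2)]]
    by (force elim!: BseqE simp: abs_le_iff)
  have "(\<lambda>n. 1 / \<rho> n) \<longlonglongrightarrow> 1 / \<eta>"
    using \<rho>(2,3) by (intro tendsto_intros) auto
  then obtain S where "\<And>n. norm (1 / \<rho> n) \<le> S"
    using convergent_imp_Bseq convergentI by (metis BseqE)
  then have S: "1 / \<rho> n \<le> S" for n
    using \<rho>(1)[of n] by (metis abs_ge_self order_trans real_norm_def)
  have val: "ennreal (\<rho> n) * a + b = ennreal (\<rho> n * p + q)" for n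
    using p q \<rho>(1)[of n] by (simp add: ennreal_mult[symmetric])
  have v: "v n \<le> ennreal (R * p + q)" for n
  proof -
    have "v n \<le> ennreal (\<rho> n) * u n + v n"
      by (simp add: add_increasing)
    also have "\<dots> \<le> ennreal (\<rho> n * p + q)"
      using le[of n] by (simp only: val)
    also have "\<dots> \<le> ennreal (R * p + q)"
      using R[of n] p(2) by (intro ennreal_leI add_right_mono mult_right_mono)
    finally show ?thesis .
  qed
  have u: "u n \<le> ennreal (p + S * q)" for n
  proof -
    have "u n = ennreal (1 / \<rho> n) * (ennreal (\<rho> n) * u n)"
      using \<rho>(1)[of n] by (simp add: mult.assoc[symmetric] ennreal_mult[symmetric])
    also have "\<dots> \<le> ennreal (1 / \<rho> n) * ennreal (\<rho> n * p + q)"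
      using order_trans[OF _ le[of n], of "ennreal (\<rho> n) * u n"]
      by (intro mult_left_mono) (simp_all add: val)
    also have "\<dots> = ennreal (p + 1 / \<rho> n * q)"
      using p q \<rho>(1)[of n] by (simp add: ennreal_mult[symmetric] field_simps del: ennreal_plus)
    also have "\<dots> \<le> ennreal (p + S * q)"
      using S[of n] q(2) by (intro ennreal_leI add_left_mono mult_right_mono)
    finally show ?thesis .
  qed
  show ?thesis
    by (rule exI[of _ "max (p + S * q) (R * p + q)"])
       (meson u v ennreal_leI max.cobounded1 max.cobounded2 order_trans)
qed

section \<open>Convergence to minimizing solutions\<close>

text \<open>The compactness argument. The last conclusion is the lower half of the squeeze
  for the penalty values: the cluster point is admissible, hence costs at least as much as the
  minimizing \<open>xd\<close>, and by lower semicontinuity it costs at most the limit inferior.\<close>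

lemma subsequence_tends_to_minimizing_solution:
  fixes \<phi> :: "'a \<Rightarrow> 'b \<Rightarrow> real" and x :: "nat \<Rightarrow> 'a" and \<rho> :: "nat \<Rightarrow> real"
  assumes A: "compactness_condition \<tau> Q \<phi> \<psi>1 \<psi>2" "sequential_lsc_condition \<tau> Q \<phi> \<psi>1 \<psi>2"
    and phi: "\<And>x. 0 \<le> \<phi> x y" "\<And>x. \<phi> x y = 0 \<Longrightarrow> K x = y"
    and x: "\<And>n. x n \<in> Q" "(\<lambda>n. \<phi> (x n) y) \<longlonglongrightarrow> 0"
    and le: "\<And>n. ennreal (\<rho> n) * \<psi>1 (x n) + \<psi>2 (x n) \<le> ennreal (\<rho> n) * \<psi>1 xd + \<psi>2 xd"
    and \<rho>: "\<And>n. 0 < \<rho> n" "\<rho> \<longlonglongrightarrow> \<eta>" "0 < \<eta>"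
    and xd: "minimizing_solution K Q \<psi>1 \<psi>2 y \<eta> xd" "\<psi>1 xd < \<infinity>" "\<psi>2 xd < \<infinity>"
  shows "\<exists>s xs. strict_mono (s :: nat \<Rightarrow> nat) \<and> minimizing_solution K Q \<psi>1 \<psi>2 y \<eta> xs \<and>
    limitin \<tau> (\<lambda>n. x (s n)) xs sequentially \<and>
    ennreal \<eta> * \<psi>1 xd + \<psi>2 xd \<le> liminf (\<lambda>n. ennreal (\<rho> (s n)) * \<psi>1 (x (s n)) + \<psi>2 (x (s n)))"
proof -
  obtain M where M: "\<And>n. \<psi>1 (x n) \<le> ennreal M" "\<And>n. \<psi>2 (x n) \<le> ennreal M"
    using penalties_bounded[OF le xd(2,3) \<rho>] by blast
  obtain C where C: "\<And>n. \<phi> (x n) y \<le> C"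
    using convergent_imp_Bseq[OF convergentI[OF x(2)]] by (force elim!: BseqE simp: abs_le_iff)
  have "\<phi> (x n) y \<le> max M C \<and> \<psi>1 (x n) \<le> ennreal (max M C) \<and> \<psi>2 (x n) \<le> ennreal (max M C)" for n
    using C[of n] M[of n] by (meson ennreal_leI max.cobounded1 max.cobounded2 order_trans)
  then obtain s xs where s: "strict_mono s" and xs: "xs \<in> Q"
    and lim: "limitin \<tau> (x \<circ> s) xs sequentially"
    using A(1)[unfolded compactness_condition_def, rule_format, of x y] x(1) by blast
  have lsc: "ennreal (\<phi> xs y) \<le> liminf (\<lambda>n. ennreal (\<phi> (x (s n)) y))"
    "\<psi>1 xs \<le> liminf (\<lambda>n. \<psi>1 (x (s n)))" "\<psi>2 xs \<le> liminf (\<lambda>n. \<psi>2 (x (s n)))"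
    using A(2)[unfolded sequential_lsc_condition_def, rule_format, of "x \<circ> s" xs y] x(1) xs lim
    by simp_all
  have \<rho>s: "(\<lambda>n. ennreal (\<rho> (s n))) \<longlonglongrightarrow> ennreal \<eta>"
    using LIMSEQ_subseq_LIMSEQ[OF \<rho>(2) s] by (simp add: o_def)
  have "(\<lambda>n. ennreal (\<phi> (x (s n)) y)) \<longlonglongrightarrow> ennreal 0"
    using LIMSEQ_subseq_LIMSEQ[OF x(2) s] by (intro tendsto_ennrealI) (simp add: o_def)
  then have "liminf (\<lambda>n. ennreal (\<phi> (x (s n)) y)) = ennreal 0"
    by (intro lim_imp_Liminf) auto
  with lsc(1) have "\<phi> xs y = 0"
    using phi(1)[of xs] by (simp add: ennreal_eq_0_iff)
  then have K: "K xs = y"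
    by (rule phi(2))
  let ?v = "\<lambda>n. ennreal (\<rho> (s n)) * \<psi>1 (x (s n)) + \<psi>2 (x (s n))"
  have "ennreal \<eta> * \<psi>1 xs + \<psi>2 xs
      \<le> liminf (\<lambda>n. ennreal (\<rho> (s n))) * liminf (\<lambda>n. \<psi>1 (x (s n))) + liminf (\<lambda>n. \<psi>2 (x (s n)))"
    using lsc(2,3) lim_imp_Liminf[OF _ \<rho>s] by (intro add_mono mult_mono) auto
  also have "\<dots> \<le> liminf (\<lambda>n. ennreal (\<rho> (s n)) * \<psi>1 (x (s n))) + liminf (\<lambda>n. \<psi>2 (x (s n)))"
    by (intro add_right_mono liminf_mult_ennreal)
  also have "\<dots> \<le> liminf ?v"
    by (rule liminf_add_ennreal)
  finally have lower: "ennreal \<eta> * \<psi>1 xs + \<psi>2 xs \<le> liminf ?v" .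
  have "(\<lambda>n. ennreal (\<rho> (s n)) * \<psi>1 xd + \<psi>2 xd) \<longlonglongrightarrow> ennreal \<eta> * \<psi>1 xd + \<psi>2 xd"
    using xd(2) by (intro tendsto_add tendsto_const tendsto_mult_ennreal \<rho>s) auto
  then have "liminf (\<lambda>n. ennreal (\<rho> (s n)) * \<psi>1 xd + \<psi>2 xd) = ennreal \<eta> * \<psi>1 xd + \<psi>2 xd"
    by (intro lim_imp_Liminf) auto
  moreover have "liminf ?v \<le> liminf (\<lambda>n. ennreal (\<rho> (s n)) * \<psi>1 xd + \<psi>2 xd)"
    by (intro Liminf_mono always_eventually allI le)
  ultimately have upper: "ennreal \<eta> * \<psi>1 xs + \<psi>2 xs \<le> ennreal \<eta> * \<psi>1 xd + \<psi>2 xd"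
    using lower by simp
  have xd_le: "ennreal \<eta> * \<psi>1 xd + \<psi>2 xd \<le> ennreal \<eta> * \<psi>1 z + \<psi>2 z" if "z \<in> Q" "K z = y" for z
    using xd(1) that by (auto simp: minimizing_solution_def is_arg_min_def not_less)
  have "minimizing_solution K Q \<psi>1 \<psi>2 y \<eta> xs"
    unfolding minimizing_solution_def is_arg_min_def
    using xs K upper xd_le by (meson leD order_trans)
  then show ?thesis
    using s lim order_trans[OF xd_le[OF xs K] lower] by (auto simp: o_def)
qed

theorem theorem3p2:
  fixes K :: "'x::banach \<Rightarrow> 'y::banach"
    and Q :: "'x set"
    and \<tau> :: "'x topology"
    and \<phi> :: "'x \<Rightarrow> 'y \<Rightarrow> real"
    and \<psi>1 \<psi>2 :: "'x \<Rightarrow> ennreal"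
    and xdag :: 'x
    and ydag :: 'y
    and D :: "real set"
    and ydel :: "real \<Rightarrow> 'y"
    and \<eta>1 \<eta>2 :: "real \<Rightarrow> real"
    and xdel :: "real \<Rightarrow> 'x"
    and c_m :: real
    and \<delta> :: "nat \<Rightarrow> real"
    and \<eta>lim :: real
  assumes K: "bounded_linear K"
    and Q: "convex Q"
    and tau: "topspace \<tau> = UNIV"
    and phi_nonneg: "\<And>x y. 0 \<le> \<phi> x y"
    and psi1: "convex_penalty \<psi>1" "lsc \<psi>1"
    and psi2: "convex_penalty \<psi>2" "lsc \<psi>2"
    and xdag: "xdag \<in> Q" "\<psi>1 xdag < \<infinity>" "\<psi>2 xdag < \<infinity>"
    and ydag: "ydag = K xdag"
    and condA: "compactness_condition \<tau> Q \<phi> \<psi>1 \<psi>2" "sequential_lsc_condition \<tau> Q \<phi> \<psi>1 \<psi>2"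
    and condB: "triangle_condition K \<phi>"
    and c_m: "1 \<le> c_m"
    and noise_levels: "\<And>d. d \<in> D \<Longrightarrow> 0 < d"
    and noise: "\<And>d. d \<in> D \<Longrightarrow> \<phi> xdag (ydel d) = d\<^sup>2"
    and eta_pos: "\<And>d. d \<in> D \<Longrightarrow> 0 < \<eta>1 d \<and> 0 < \<eta>2 d"
    and minimizer: "\<And>d. d \<in> D \<Longrightarrow>
          is_arg_min (tikhonov \<phi> \<psi>1 \<psi>2 (ydel d) (\<eta>1 d) (\<eta>2 d)) (\<lambda>x. x \<in> Q) (xdel d)"
    and discrepancy: "\<And>d. d \<in> D \<Longrightarrow> \<phi> (xdel d) (ydel d) = c_m * d\<^sup>2"
    and subseq: "\<And>n. \<delta> n \<in> D" "\<delta> \<longlonglongrightarrow> 0"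
    and eta_conv: "convergent (\<lambda>n. (\<eta>1 (\<delta> n), \<eta>2 (\<delta> n)))"
    and ratio: "(\<lambda>n. \<eta>1 (\<delta> n) / \<eta>2 (\<delta> n)) \<longlonglongrightarrow> \<eta>lim" "0 < \<eta>lim"
    and xdag_min: "minimizing_solution K Q \<psi>1 \<psi>2 ydag \<eta>lim xdag"
  shows "(\<exists>r xs. strict_mono (r :: nat \<Rightarrow> nat) \<and>
            minimizing_solution K Q \<psi>1 \<psi>2 ydag \<eta>lim xs \<and>
            limitin \<tau> (\<lambda>n. xdel (\<delta> (r n))) xs sequentially) \<and>
         (\<lambda>n. ennreal (\<eta>1 (\<delta> n) / \<eta>2 (\<delta> n)) * \<psi>1 (xdel (\<delta> n)) + \<psi>2 (xdel (\<delta> n)))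
            \<longlonglongrightarrow> ennreal \<eta>lim * \<psi>1 xdag + \<psi>2 xdag \<and>
         (\<forall>xs. minimizing_solution K Q \<psi>1 \<psi>2 ydag \<eta>lim xs \<and>
            (\<forall>x. minimizing_solution K Q \<psi>1 \<psi>2 ydag \<eta>lim x \<longrightarrow> x = xs) \<longrightarrow>
            limitin \<tau> (\<lambda>n. xdel (\<delta> n)) xs sequentially)"
proof -
  define x where "x n = xdel (\<delta> n)" for n
  define \<rho> where "\<rho> n = \<eta>1 (\<delta> n) / \<eta>2 (\<delta> n)" for n
  define V where "V = ennreal \<eta>lim * \<psi>1 xdag + \<psi>2 xdag"
  define v where "v n = ennreal (\<rho> n) * \<psi>1 (x n) + \<psi>2 (x n)" for n
  let ?min = "minimizing_solution K Q \<psi>1 \<psi>2 ydag \<eta>lim"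
  have \<rho>: "\<And>n. 0 < \<rho> n" "\<rho> \<longlonglongrightarrow> \<eta>lim" "0 < \<eta>lim"
    using eta_pos[OF subseq(1)] ratio unfolding \<rho>_def by simp_all
  have xQ: "x n \<in> Q" for n
    using minimizer[OF subseq(1)[of n]] by (simp add: x_def is_arg_min_def)
  have le: "v n \<le> ennreal (\<rho> n) * \<psi>1 xdag + \<psi>2 xdag" for n
  proof -
    have "\<phi> xdag (ydel (\<delta> n)) \<le> \<phi> (xdel (\<delta> n)) (ydel (\<delta> n))"
      using noise[OF subseq(1)[of n]] discrepancy[OF subseq(1)[of n]]
        mult_right_mono[OF c_m, of "(\<delta> n)\<^sup>2"] by simp
    then show ?thesis
      using discrepancy_penalty_le[OF minimizer[OF subseq(1)[of n]] xdag(1)] eta_pos[OF subseq(1)[of n]]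
      by (simp add: v_def \<rho>_def x_def)
  qed
  obtain c where c: "\<And>x x' y y'. K x' = y \<Longrightarrow> \<phi> x y \<le> c * (\<phi> x' y' + \<phi> x y')"
    using condB unfolding triangle_condition_def by blast
  have fid: "(\<lambda>n. \<phi> (x n) ydag) \<longlonglongrightarrow> 0"
  proof (rule tendsto_sandwich)
    show "eventually (\<lambda>n. 0 \<le> \<phi> (x n) ydag) sequentially"
      by (intro always_eventually allI phi_nonneg)
    have "\<phi> (x n) ydag \<le> c * ((\<delta> n)\<^sup>2 + c_m * (\<delta> n)\<^sup>2)" for n
      using c[of xdag ydag "x n" "ydel (\<delta> n)"] ydag noise[OF subseq(1)[of n]]
        discrepancy[OF subseq(1)[of n]] by (simp add: x_def)
    then show "eventually (\<lambda>n. \<phi> (x n) ydag \<le> c * ((\<delta> n)\<^sup>2 + c_m * (\<delta> n)\<^sup>2)) sequentially"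
      by (intro always_eventually allI)
    have "(\<lambda>n. c * ((\<delta> n)\<^sup>2 + c_m * (\<delta> n)\<^sup>2)) \<longlonglongrightarrow> c * (0\<^sup>2 + c_m * 0\<^sup>2)"
      by (intro tendsto_intros subseq(2))
    then show "(\<lambda>n. c * ((\<delta> n)\<^sup>2 + c_m * (\<delta> n)\<^sup>2)) \<longlonglongrightarrow> 0"
      by simp
  qed simp
  have sub: "\<exists>s xs. strict_mono (s :: nat \<Rightarrow> nat) \<and> ?min xs \<and>
      limitin \<tau> (\<lambda>n. x (r (s n))) xs sequentially \<and> V \<le> liminf (\<lambda>n. v (r (s n)))"
    if r: "strict_mono r" for r :: "nat \<Rightarrow> nat"
    unfolding V_def v_def
  proof (rule subsequence_tends_to_minimizing_solution[where x = "\<lambda>n. x (r n)" and \<rho> = "\<lambda>n. \<rho> (r n)",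
        OF condA phi_nonneg])
    show "K z = ydag" if "\<phi> z ydag = 0" for z
      using condB that by (simp add: triangle_condition_def)
    show "(\<lambda>n. \<phi> (x (r n)) ydag) \<longlonglongrightarrow> 0"
      using LIMSEQ_subseq_LIMSEQ[OF fid r] by (simp add: o_def)
    show "(\<lambda>n. \<rho> (r n)) \<longlonglongrightarrow> \<eta>lim"
      using LIMSEQ_subseq_LIMSEQ[OF \<rho>(2) r] by (simp add: o_def)
    show "ennreal (\<rho> (r n)) * \<psi>1 (x (r n)) + \<psi>2 (x (r n)) \<le> ennreal (\<rho> (r n)) * \<psi>1 xdag + \<psi>2 xdag"
      for n using le[of "r n"] by (simp add: v_def)
  qed (use xQ \<rho> xdag_min xdag in auto)
  have exists: "\<exists>r xs. strict_mono (r :: nat \<Rightarrow> nat) \<and> ?min xs \<and>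
      limitin \<tau> (\<lambda>n. x (r n)) xs sequentially"
    using sub[OF strict_mono_id] by auto
  have val: "v \<longlonglongrightarrow> V"
  proof (rule order_tendstoI)
    fix a assume "a < V"
    show "eventually (\<lambda>n. a < v n) sequentially"
      by (rule eventually_sequentially_if_subsequences)
         (metis sub le_Liminf_iff \<open>a < V\<close>)
  next
    fix a assume "V < a"
    have "(\<lambda>n. ennreal (\<rho> n) * \<psi>1 xdag + \<psi>2 xdag) \<longlonglongrightarrow> V"
      unfolding V_def using xdag(2) \<rho>(2)
      by (intro tendsto_add tendsto_const tendsto_mult_ennreal tendsto_ennrealI) auto
    then have "eventually (\<lambda>n. ennreal (\<rho> n) * \<psi>1 xdag + \<psi>2 xdag < a) sequentially"
      using \<open>V < a\<close> by (rule order_tendstoD)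
    then show "eventually (\<lambda>n. v n < a) sequentially"
      by (rule eventually_mono) (use le in \<open>auto intro: le_less_trans\<close>)
  qed
  have unique: "limitin \<tau> x xs sequentially" if "\<And>z. ?min z \<Longrightarrow> z = xs" for xs
    unfolding limitin_def
  proof (intro conjI allI impI)
    show "xs \<in> topspace \<tau>"
      by (simp add: tau)
    fix U assume U: "openin \<tau> U \<and> xs \<in> U"
    show "eventually (\<lambda>n. x n \<in> U) sequentially"
    proof (rule eventually_sequentially_if_subsequences)
      fix r :: "nat \<Rightarrow> nat" assume "strict_mono r"
      from sub[OF this] obtain s z where "?min z" "limitin \<tau> (\<lambda>n. x (r (s n))) z sequentially"
        by blast
      then have "limitin \<tau> (\<lambda>n. x (r (s n))) xs sequentially"
        using that by simp
      then show "\<exists>s. eventually (\<lambda>n. x (r (s n)) \<in> U) sequentially"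
        using U unfolding limitin_def by blast
    qed
  qed
  show ?thesis
    using exists val unique unfolding x_def v_def \<rho>_def V_def by blast
qed

end
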